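(* Let $n\ge 1$. For a polynomial $f\in\mathbb{R}[\underline{X}]=\mathbb{R}[X_1,\ldots,X_n]$, the following are equivalent: (1) $f(0)\ge 0$; (2) $f$ is a coefficientwise limit of squares of polynomials in $\mathbb{R}[\underline{X}]$; (3) $f$ is a coefficientwise limit of elements of $\sum\mathbb{R}[\underline{X}]^2$.
   Context: $\sum\mathbb{R}[\underline{X}]^2$ is the set of all finite sums of squares of polynomials. A net $\{f_i\}$ in $\mathbb{R}[\underline{X}]$ converges in the coefficientwise convergent topology to $f\in\mathbb{R}[\underline{X}]$ if for every $\alpha\in\mathbb{N}^n$ (with $\mathbb{N}=\{0,1,2,\ldots\}$) the coefficient of $\underline{X}^\alpha=X_1^{\alpha_1}\cdots X_n^{\alpha_n}$ in $f_i$ converges in $\mathbb{R}$ to the coefficient of $\underline{X}^\alpha$ in $f$. "Coefficientwise limit" means limit in this sense. *)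

theory Defs
  imports "HOL-Analysis.Analysis" "HOL-Library.Poly_Mapping"
begin

(* Real polynomials in CARD('n) variables: finitely supported coefficient functions on the
   monomials 'n \<Rightarrow>\<^sub>0 nat (exponent vectors alpha), with convolution as multiplication. *)
type_synonym 'n rpoly = "('n \<Rightarrow>\<^sub>0 nat) \<Rightarrow>\<^sub>0 real"

abbreviation pcoeff :: "'n rpoly \<Rightarrow> ('n \<Rightarrow>\<^sub>0 nat) \<Rightarrow> real" where
  "pcoeff \<equiv> Poly_Mapping.lookup"

definition peval :: "('n::finite) rpoly \<Rightarrow> real ^ 'n \<Rightarrow> real" where
  "peval f x =
     (\<Sum>\<alpha>\<in>Poly_Mapping.keys f. pcoeff f \<alpha> * (\<Prod>i\<in>UNIV. (x $ i) ^ Poly_Mapping.lookup \<alpha> i))"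

definition squares :: "'n rpoly set" where
  "squares = {p\<^sup>2 | p. True}"

definition sums_of_squares :: "'n rpoly set" where
  "sums_of_squares = {(\<Sum>i<k. (p i)\<^sup>2) | (k::nat) p. True}"

definition directed_on :: "'i set \<Rightarrow> ('i \<Rightarrow> 'i \<Rightarrow> bool) \<Rightarrow> bool" where
  "directed_on D le \<longleftrightarrow> D \<noteq> {} \<and> (\<forall>i\<in>D. le i i)
     \<and> (\<forall>i\<in>D. \<forall>j\<in>D. \<forall>k\<in>D. le i j \<longrightarrow> le j k \<longrightarrow> le i k)
     \<and> (\<forall>i\<in>D. \<forall>j\<in>D. \<exists>k\<in>D. le i k \<and> le j k)"

definition tails :: "'i set \<Rightarrow> ('i \<Rightarrow> 'i \<Rightarrow> bool) \<Rightarrow> 'i filter" where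
  "tails D le = (INF i\<in>D. principal {j\<in>D. le i j})"

definition net_converges_coeffwise ::
  "'i set \<Rightarrow> ('i \<Rightarrow> 'i \<Rightarrow> bool) \<Rightarrow> ('i \<Rightarrow> 'n rpoly) \<Rightarrow> 'n rpoly \<Rightarrow> bool" where
  "net_converges_coeffwise D le g f \<longleftrightarrow>
     (\<forall>\<alpha>. ((\<lambda>i. pcoeff (g i) \<alpha>) \<longlongrightarrow> pcoeff f \<alpha>) (tails D le))"

(* HOL cannot quantify over the type of the index set. Sets of polynomials are enough as
   indices: by coeffwise_limitI below, nets indexed by any other type yield no further limits. *)
definition coeffwise_limit :: "'n rpoly set \<Rightarrow> 'n rpoly \<Rightarrow> bool" where
  "coeffwise_limit S f \<longleftrightarrow>
     (\<exists>(D :: 'n rpoly set set) le g. directed_on D le \<and> (\<forall>i\<in>D. g i \<in> S)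
        \<and> net_converges_coeffwise D le g f)"

lemma eventually_tails:
  assumes "directed_on D le"
  shows "eventually P (tails D le) \<longleftrightarrow> (\<exists>i\<in>D. \<forall>j\<in>D. le i j \<longrightarrow> P j)"
proof -
  have "eventually P (tails D le) \<longleftrightarrow> (\<exists>i\<in>D. eventually P (principal {j\<in>D. le i j}))"
    unfolding tails_def
  proof (rule eventually_INF_base)
    show "D \<noteq> {}"
      using assms by (simp add: directed_on_def)
    fix i j assume ij: "i \<in> D" "j \<in> D"
    then obtain k where k: "k \<in> D" "le i k" "le j k"
      using assms unfolding directed_on_def by blast
    then have "{l\<in>D. le k l} \<subseteq> {l\<in>D. le i l} \<inter> {l\<in>D. le j l}"
      using assms ij unfolding directed_on_def by blast
    then show "\<exists>x\<in>D. principal {l\<in>D. le x l} \<le>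
        inf (principal {l\<in>D. le i l}) (principal {l\<in>D. le j l})"
      using k(1) by auto
  qed
  then show ?thesis
    by (auto simp: eventually_principal)
qed

lemma coeffwise_limitI:
  fixes D :: "'i set" and g :: "'i \<Rightarrow> 'n rpoly"
  assumes dir: "directed_on D le" and S: "\<forall>i\<in>D. g i \<in> S"
    and conv: "net_converges_coeffwise D le g f"
  shows "coeffwise_limit S f"
proof -
  define N where "N A e = {h. \<forall>\<alpha>\<in>A. dist (pcoeff h \<alpha>) (pcoeff f \<alpha>) < e}"
    for A :: "('n \<Rightarrow>\<^sub>0 nat) set" and e :: real
  define E where "E = {N A e | A e. finite A \<and> e > 0}"
  define le' where "le' U V \<longleftrightarrow> V \<subseteq> U" for U V :: "'n rpoly set"
  have NE: "N A e \<in> E" if "finite A" "e > 0" for A e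
    using that unfolding E_def by blast
  have ne: "\<exists>h. h \<in> U \<and> h \<in> S" if U: "U \<in> E" for U
  proof -
    obtain A e where Ae: "U = N A e" "finite A" "e > 0"
      using U unfolding E_def by blast
    have "\<forall>\<^sub>F i in tails D le. \<forall>\<alpha>\<in>A. dist (pcoeff (g i) \<alpha>) (pcoeff f \<alpha>) < e"
    proof (rule eventually_ball_finite[OF Ae(2)], rule ballI)
      show "\<forall>\<^sub>F i in tails D le. dist (pcoeff (g i) \<alpha>) (pcoeff f \<alpha>) < e" for \<alpha>
        using conv tendstoD Ae(3) unfolding net_converges_coeffwise_def by blast
    qed
    then obtain i where i: "i \<in> D" "\<forall>j\<in>D. le i j \<longrightarrow>
        (\<forall>\<alpha>\<in>A. dist (pcoeff (g j) \<alpha>) (pcoeff f \<alpha>) < e)"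
      unfolding eventually_tails[OF dir] by blast
    moreover have "le i i"
      using dir i(1) by (simp add: directed_on_def)
    ultimately have "g i \<in> U"
      unfolding Ae N_def by blast
    then show ?thesis
      using S i(1) by blast
  qed
  define g' where "g' U = (SOME h. h \<in> U \<and> h \<in> S)" for U
  have g': "g' U \<in> U" "g' U \<in> S" if "U \<in> E" for U
    using someI_ex[OF ne[OF that]] unfolding g'_def by auto
  have dir': "directed_on E le'"
    unfolding directed_on_def
  proof (intro conjI ballI)
    show "E \<noteq> {}"
      using NE[of "{}" 1] by auto
    fix U V assume "U \<in> E" "V \<in> E"
    then obtain A e B d where "U = N A e" "finite A" "e > 0" "V = N B d" "finite B" "d > 0"
      unfolding E_def by blast
    then have "N (A \<union> B) (min e d) \<in> E" "N (A \<union> B) (min e d) \<subseteq> U" "N (A \<union> B) (min e d) \<subseteq> V"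
      using NE[of "A \<union> B" "min e d"] by (simp_all add: N_def subset_iff)
    then show "\<exists>W\<in>E. le' U W \<and> le' V W"
      unfolding le'_def by blast
  qed (simp_all add: le'_def subset_iff)
  have "net_converges_coeffwise E le' g' f"
    unfolding net_converges_coeffwise_def
  proof (intro allI tendstoI)
    fix \<alpha> and e :: real assume "e > 0"
    then have "N {\<alpha>} e \<in> E"
      by (simp add: NE)
    moreover have "dist (pcoeff (g' U) \<alpha>) (pcoeff f \<alpha>) < e" if "U \<in> E" "le' (N {\<alpha>} e) U" for U
      using g'(1)[OF that(1)] that(2) unfolding le'_def N_def by auto
    ultimately show "\<forall>\<^sub>F U in tails E le'. dist (pcoeff (g' U) \<alpha>) (pcoeff f \<alpha>) < e"
      unfolding eventually_tails[OF dir'] by blast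
  qed
  then show ?thesis
    unfolding coeffwise_limit_def
    by (intro exI[of _ E] exI[of _ le'] exI[of _ g'] conjI ballI dir' g'(2))
qed

end

theory Submission
  imports Defs
begin

text \<open>
  Evaluation at the origin reads off the coefficient of the trivial monomial, so it is continuous
  for coefficientwise convergence; it is multiplicative, hence nonnegative on sums of squares. A
  limit of sums of squares therefore satisfies \<open>f(0) \<ge> 0\<close>, and a square is a sum of one square.

  The substance is that \<open>f(0) \<ge> 0\<close> makes \<open>f\<close> a limit of squares. A polynomial with positive
  constant term is a square in the ring of formal power series, so it agrees with the square of
  a polynomial up to any prescribed total degree (\<open>square_agrees_up_to_degree\<close>). No power series
  are needed: the iteration \<open>s \<mapsto> s + t (f - s\<^sup>2)\<close> with \<open>t = 1 / (2 \<surd>f(0))\<close>, which is Newton's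
  method with the derivative frozen at the initial value \<open>\<surd>f(0)\<close>, multiplies the error
  \<open>f - s\<^sup>2\<close> by a polynomial without constant term, and thus raises its lowest degree at every
  step. If \<open>f(0)\<close> is only nonnegative, apply this to \<open>f + 1/(m+1)\<close> up to degree \<open>m\<close>: the
  coefficient of each monomial of the resulting squares is eventually that of \<open>f + 1/(m+1)\<close>,
  which tends to that of \<open>f\<close>.
\<close>

lemma pcoeff_mult_0:
  fixes p q :: "'n rpoly"
  shows "pcoeff (p * q) 0 = pcoeff p 0 * pcoeff q 0"
proof -
  have split: "(0 = a + b) \<longleftrightarrow> a = 0 \<and> b = 0" for a b :: "'n \<Rightarrow>\<^sub>0 nat"
    by (auto simp: poly_mapping_eq_iff lookup_add fun_eq_iff)
  have "(\<Sum>b. pcoeff q b when (0::'n \<Rightarrow>\<^sub>0 nat) = a + b) = (pcoeff q 0 when a = 0)" for a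
    by (cases "a = 0") (simp_all add: split)
  then show ?thesis
    by (simp add: lookup_mult mult_when)
qed

lemma pcoeff_sum_squares_0_nonneg: "pcoeff (\<Sum>i<k. (p i)\<^sup>2 :: 'n rpoly) 0 \<ge> 0" for k :: nat
  by (simp add: lookup_sum sum_nonneg power2_eq_square pcoeff_mult_0)

lemma peval_0:
  fixes f :: "('n::finite) rpoly"
  shows "peval f 0 = pcoeff f 0"
proof -
  have monom: "(\<Prod>i\<in>UNIV. ((0::real ^ 'n) $ i) ^ Poly_Mapping.lookup \<alpha> i)
      = (if \<alpha> = 0 then 1 else 0)" for \<alpha> :: "'n \<Rightarrow>\<^sub>0 nat"
  proof (cases "\<alpha> = 0")
    case False
    then obtain i where "Poly_Mapping.lookup \<alpha> i \<noteq> 0"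
      by (auto simp: poly_mapping_eq_iff fun_eq_iff)
    then show ?thesis
      using False by (auto intro!: prod_zero bexI[of _ i])
  qed simp
  show ?thesis
    unfolding peval_def monom by (simp add: if_distrib sum.delta' in_keys_iff cong: if_cong)
qed

definition total_degree :: "('n::finite \<Rightarrow>\<^sub>0 nat) \<Rightarrow> nat" where
  "total_degree \<alpha> = (\<Sum>i\<in>UNIV. Poly_Mapping.lookup \<alpha> i)"

lemma total_degree_add: "total_degree (\<alpha> + \<beta>) = total_degree \<alpha> + total_degree \<beta>"
  by (simp add: total_degree_def lookup_add sum.distrib)

lemma total_degree_pos: "\<alpha> \<noteq> 0 \<Longrightarrow> total_degree \<alpha> > 0"
  by (auto simp: total_degree_def poly_mapping_eq_iff fun_eq_iff sum_nonneg_eq_0_iff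
      intro!: Nat.gr0I)

text \<open>A factor without constant term involves only monomials of positive degree, so it raises the
  lowest degree of a product.\<close>

lemma lowest_degree_mult:
  fixes p q :: "('n::finite) rpoly"
  assumes p: "\<And>\<alpha>. \<alpha> \<in> Poly_Mapping.keys p \<Longrightarrow> k \<le> total_degree \<alpha>"
    and q: "pcoeff q 0 = 0"
    and \<alpha>: "\<alpha> \<in> Poly_Mapping.keys (p * q)"
  shows "Suc k \<le> total_degree \<alpha>"
proof -
  obtain \<beta> \<gamma> where *: "\<alpha> = \<beta> + \<gamma>" "\<beta> \<in> Poly_Mapping.keys p" "\<gamma> \<in> Poly_Mapping.keys q"
    using \<alpha> keys_mult[of p q] by blast
  then have "\<gamma> \<noteq> 0"
    using q by (auto simp: in_keys_iff)
  then show ?thesis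
    using p[OF *(2)] total_degree_pos[of \<gamma>] *(1) by (simp add: total_degree_add)
qed

text \<open>The induction keeps the constant term of the approximate root equal to \<open>\<surd>f(0)\<close>: this is what
  cancels the constant term of the factor by which the error changes.\<close>

lemma approximate_sqrt:
  fixes f :: "('n::finite) rpoly"
  assumes pos: "pcoeff f 0 > 0"
  shows "\<exists>s. pcoeff s 0 = sqrt (pcoeff f 0) \<and>
    (\<forall>\<alpha>\<in>Poly_Mapping.keys (f - s\<^sup>2). k \<le> total_degree \<alpha>)"
proof (induction k)
  case 0
  show ?case
    by (rule exI[of _ "Poly_Mapping.single 0 (sqrt (pcoeff f 0))"]) simp
next
  case (Suc k)
  then obtain s where s0: "pcoeff s 0 = sqrt (pcoeff f 0)"
    and s: "\<And>\<alpha>. \<alpha> \<in> Poly_Mapping.keys (f - s\<^sup>2) \<Longrightarrow> k \<le> total_degree \<alpha>"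
    by blast
  define t :: "'n rpoly" where "t = Poly_Mapping.single 0 (1 / (2 * sqrt (pcoeff f 0)))"
  define e where "e = f - s\<^sup>2"
  define s' where "s' = s + t * e"
  have e0: "pcoeff e 0 = 0"
    using pos by (simp add: e_def lookup_minus power2_eq_square pcoeff_mult_0 s0)
  have "f - s'\<^sup>2 = e * (1 - (t * s + t * s) - t * t * e)"
    by (simp add: s'_def e_def power2_eq_square algebra_simps)
  moreover have "pcoeff (1 - (t * s + t * s) - t * t * e) 0 = 0"
    using pos unfolding lookup_minus lookup_add by (simp add: pcoeff_mult_0 e0 s0 t_def)
  ultimately have "\<forall>\<alpha>\<in>Poly_Mapping.keys (f - s'\<^sup>2). Suc k \<le> total_degree \<alpha>"
    using lowest_degree_mult[of e k] s unfolding e_def by metis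
  moreover have "pcoeff s' 0 = sqrt (pcoeff f 0)"
    by (simp add: s'_def lookup_add pcoeff_mult_0 e0 s0)
  ultimately show ?case
    by blast
qed

lemma square_agrees_up_to_degree:
  fixes f :: "('n::finite) rpoly"
  assumes "pcoeff f 0 > 0"
  shows "\<exists>s. \<forall>\<alpha>. total_degree \<alpha> \<le> m \<longrightarrow> pcoeff (s\<^sup>2) \<alpha> = pcoeff f \<alpha>"
proof -
  obtain s where "\<forall>\<alpha>\<in>Poly_Mapping.keys (f - s\<^sup>2). Suc m \<le> total_degree \<alpha>"
    using approximate_sqrt[OF assms] by blast
  then have "pcoeff (s\<^sup>2) \<alpha> = pcoeff f \<alpha>" if "total_degree \<alpha> \<le> m" for \<alpha>
    using that by (metis Suc_n_not_le_n eq_iff_diff_eq_0 in_keys_iff le_trans lookup_minus)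
  then show ?thesis
    by blast
qed

lemma coeffwise_limit_sequenceI:
  fixes g :: "nat \<Rightarrow> 'n rpoly"
  assumes "\<And>m. g m \<in> S" and conv: "\<And>\<alpha>. (\<lambda>m. pcoeff (g m) \<alpha>) \<longlonglongrightarrow> pcoeff f \<alpha>"
  shows "coeffwise_limit S f"
proof (rule coeffwise_limitI)
  show dir: "directed_on (UNIV :: nat set) (\<le>)"
    unfolding directed_on_def by (auto intro: max.cobounded1 max.cobounded2)
  have "tails (UNIV :: nat set) (\<le>) = sequentially"
    by (simp add: filter_eq_iff eventually_tails[OF dir] eventually_sequentially)
  then show "net_converges_coeffwise (UNIV :: nat set) (\<le>) g f"
    using conv by (simp add: net_converges_coeffwise_def)
qed (use assms in blast)

lemma coeffwise_limit_mono: "coeffwise_limit S f \<Longrightarrow> S \<subseteq> T \<Longrightarrow> coeffwise_limit T f"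
  unfolding coeffwise_limit_def by blast

lemma squares_subset_sums_of_squares: "squares \<subseteq> (sums_of_squares :: 'n rpoly set)"
proof
  fix h :: "'n rpoly"
  assume "h \<in> squares"
  then obtain p where "h = p\<^sup>2"
    by (auto simp: squares_def)
  then show "h \<in> sums_of_squares"
    unfolding sums_of_squares_def by (intro CollectI exI[of _ "1::nat"] exI[of _ "\<lambda>_. p"]) simp
qed

lemma coeffwise_limit_squares_if_nonneg:
  fixes f :: "('n::finite) rpoly"
  assumes "pcoeff f 0 \<ge> 0"
  shows "coeffwise_limit squares f"
proof -
  \<comment> \<open>the shift makes the constant term positive, as the approximate square roots require\<close>
  define h where "h m = f + Poly_Mapping.single 0 (inverse (real (Suc m)))" for m
  have "pcoeff (h m) 0 > 0" for m
    using assms by (simp add: h_def lookup_add add_nonneg_pos)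
  then have "\<forall>m. \<exists>s. \<forall>\<alpha>. total_degree \<alpha> \<le> m \<longrightarrow> pcoeff (s\<^sup>2) \<alpha> = pcoeff (h m) \<alpha>"
    using square_agrees_up_to_degree by blast
  then obtain s where s: "\<And>m \<alpha>. total_degree \<alpha> \<le> m \<Longrightarrow> pcoeff ((s m)\<^sup>2) \<alpha> = pcoeff (h m) \<alpha>"
    by metis
  show ?thesis
  proof (rule coeffwise_limit_sequenceI)
    show "(s m)\<^sup>2 \<in> squares" for m
      by (auto simp: squares_def)
    fix \<alpha> :: "'n \<Rightarrow>\<^sub>0 nat"
    have "(\<lambda>m. pcoeff (h m) \<alpha>) \<longlonglongrightarrow> pcoeff f \<alpha>"
      using tendsto_add[OF tendsto_const LIMSEQ_inverse_real_of_nat, of "pcoeff f \<alpha>"]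
      by (cases "\<alpha> = 0") (simp_all add: h_def lookup_add lookup_single)
    moreover have "\<forall>\<^sub>F m in sequentially. pcoeff (h m) \<alpha> = pcoeff ((s m)\<^sup>2) \<alpha>"
      using eventually_ge_at_top[of "total_degree \<alpha>"] by eventually_elim (simp add: s)
    ultimately show "(\<lambda>m. pcoeff ((s m)\<^sup>2) \<alpha>) \<longlonglongrightarrow> pcoeff f \<alpha>"
      by (rule Lim_transform_eventually)
  qed
qed

lemma nonneg_if_coeffwise_limit_sums_of_squares:
  fixes f :: "'n rpoly"
  assumes "coeffwise_limit sums_of_squares f"
  shows "pcoeff f 0 \<ge> 0"
proof -
  obtain D :: "'n rpoly set set" and le g where dir: "directed_on D le"
    and g: "\<forall>i\<in>D. g i \<in> sums_of_squares" and conv: "net_converges_coeffwise D le g f"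
    using assms unfolding coeffwise_limit_def by blast
  have ne: "D \<noteq> {}" and refl: "\<forall>i\<in>D. le i i"
    using dir by (simp_all add: directed_on_def)
  have "\<forall>i\<in>D. pcoeff (g i) 0 \<ge> 0"
    using g pcoeff_sum_squares_0_nonneg by (fastforce simp: sums_of_squares_def)
  then have "\<forall>\<^sub>F i in tails D le. pcoeff (g i) 0 \<ge> 0"
    using ne unfolding eventually_tails[OF dir] by blast
  moreover have "tails D le \<noteq> bot"
    using refl unfolding trivial_limit_def eventually_tails[OF dir] by blast
  moreover have "((\<lambda>i. pcoeff (g i) 0) \<longlongrightarrow> pcoeff f 0) (tails D le)"
    using conv by (simp add: net_converges_coeffwise_def)
  ultimately show ?thesis
    by (intro tendsto_lowerbound)
qed

theorem proposition3p16:
  fixes f :: "('n::finite) rpoly"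
  shows "(peval f 0 \<ge> 0 \<longleftrightarrow> coeffwise_limit squares f)
    \<and> (coeffwise_limit squares f \<longleftrightarrow> coeffwise_limit sums_of_squares f)"
  using coeffwise_limit_squares_if_nonneg[of f] nonneg_if_coeffwise_limit_sums_of_squares[of f]
    coeffwise_limit_mono[OF _ squares_subset_sums_of_squares, of f]
  unfolding peval_0 by blast

end
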